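(* Let $(R,\oplus,\otimes)=(\mathbb{R}\cup\{+\infty\},\min,+)$, let $c_\alpha\le 0$ for all $\alpha\in\Pi^\circ$, and assume that $\Gamma$ contains at least one word of length $1$. Let $\Pi$ be a set of patterns such that $\Pi_0=\{\varepsilon_0\}$ and $\Pi$ contains the set $\widetilde\Pi$ of all patterns $\beta$ for which there exists a labeling $x\alpha\beta\gamma y\in D^{1:n}$ such that (a) $\alpha\beta,\beta\gamma\in\Pi^\circ$ and (b) $\langle x\alpha|\beta|\gamma y\rangle\cap\Pi^\circ=\varnothing$. Consider the following algorithm. 1. Set $M_0(\varepsilon_0):=0$. 2. For $s=1,\ldots,n$, traverse the nodes $\alpha\in\Pi_s$ of the forest $G[\Pi_s]$ starting from the leaves and set $$M_s(\alpha):=\min\Big\{M_p(\alpha^\leftarrow)+\psi(\alpha),\ \min_{(\alpha,\beta)\in E[\Pi_s]}M_s(\beta)\Big\},$$ where $p$ is the end position of $\alpha^\leftarrow$ and $\psi(\alpha)=f(\alpha)-f(\alpha^\leftarrow)$; if $\alpha^\leftarrow$ is undefined, the first expression is ignored. 3. Return $\min_{\alpha\in\Pi_n}M_n(\alpha)$. Then the algorithm returns the correct value of $Z=\min_{x\in D^{1:n}}f(x)$.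
   Context: $D$ is a finite alphabet, $n\ge1$, $\Gamma$ is a finite set of non-empty words over $D$. A pattern is a pair $\alpha=([i,j],w)$ where $[i,j]$ is an integer interval in $[1,n]$, possibly empty ($j\ge i-1$), and $w=w_i\ldots w_j$ is a word over $D$ of length $|\alpha|=j-i+1$; its end position is $j$. For $s\in[0,n]$, $\varepsilon_s=([s+1,s],\varepsilon)$ is the empty pattern at $s$. The concatenation of $([i,j],w)$ and $([j+1,k],v)$ is $([i,k],wv)$; whenever a concatenation is written the intervals are assumed adjacent, and factors may be empty unless stated otherwise. The symbol $\ast$ denotes an arbitrary possibly empty pattern and $+$ an arbitrary non-empty pattern (e.g. $x=\ast\alpha\ast$ means $\alpha$ is a subpattern of $x$ at its own position). $D^{i:j}$ is the set of patterns with interval $[i,j]$. $\Pi^\circ=\{([i,j],\alpha)\mid\alpha\in\Gamma,\ [i,j]\subseteq[1,n],\ j-i+1=|\alpha|\}$. $\Pi_s$ is the set of patterns in $\Pi$ ending at position $s$. $G[\Pi_s]=(\Pi_s,E[\Pi_s])$ is the Hasse diagram of $\Pi_s$ under the order "$\alpha\preceq\beta$ iff $\alpha$ is a suffix of $\beta$", with $(\alpha,\beta)\in E[\Pi_s]$ iff $\alpha\prec\beta$ and no $\gamma\in\Pi_s$ has $\alpha\prec\gamma\prec\beta$; it is a directed forest. $f(x)=\sum_{\alpha\in\Pi^\circ,\,x=\ast\alpha\ast}c_\alpha$ (empty sum $=0$). For $\alpha\in\Pi$, $\alpha^\leftarrow$ is the longest proper prefix of $\alpha$ that is in $\Pi$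 ($\alpha=\alpha^\leftarrow+$, $\alpha^\leftarrow\in\Pi$), undefined if $\Pi$ contains no proper prefix of $\alpha$. For patterns $\alpha,\beta,\gamma$, $\langle\alpha|\beta|\gamma\rangle=\{u\mid u=+\beta+,\ \alpha\beta\gamma=\ast u\ast\}$. The minimum over an empty set is $+\infty$. *)

theory Defs
  imports "HOL-Library.Extended_Real"
begin

text \<open>
  \<open>Pat i j w\<close> is the pattern \<open>([i,j],w)\<close>. The condition \<open>hi p + 1 = lo p + length (word p)\<close> of
  \<open>wf_pat\<close> is \<open>|w| = j - i + 1\<close> without truncated subtraction; together with \<open>1 \<le> lo p\<close> it admits
  exactly the intervals with \<open>j \<ge> i - 1 \<ge> 0\<close>, empty ones included.
\<close>

datatype 'd pattern = Pat (lo: nat) (hi: nat) (word: "'d list")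

definition wf_pat :: "'d pattern \<Rightarrow> bool" where
  "wf_pat p \<longleftrightarrow> 1 \<le> lo p \<and> hi p + 1 = lo p + length (word p)"

definition patterns :: "'d set \<Rightarrow> nat \<Rightarrow> 'd pattern set" where
  "patterns D n = {p. wf_pat p \<and> hi p \<le> n \<and> set (word p) \<subseteq> D}"

definition empty_pat :: "nat \<Rightarrow> 'd pattern" where
  "empty_pat s = Pat (s + 1) s []"

definition labelings :: "'d set \<Rightarrow> nat \<Rightarrow> nat \<Rightarrow> nat \<Rightarrow> 'd pattern set" where
  "labelings D n i j = {p \<in> patterns D n. lo p = i \<and> hi p = j}"

definition adjacent :: "'d pattern \<Rightarrow> 'd pattern \<Rightarrow> bool" where
  "adjacent p q \<longleftrightarrow> lo q = hi p + 1"

text \<open>\<open>p \<cdot> q\<close> is meaningful only if \<open>adjacent p q\<close>, which is required explicitly wherever it is used.\<close>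

definition cat :: "'d pattern \<Rightarrow> 'd pattern \<Rightarrow> 'd pattern" (infixl "\<cdot>" 70) where
  "p \<cdot> q = Pat (lo p) (hi q) (word p @ word q)"

text \<open>In turn: \<open>x = *\<alpha>*\<close>, \<open>u = +\<beta>+\<close>, \<open>\<beta> = \<alpha>+\<close> and \<open>\<beta> = *\<alpha>\<close>.\<close>

definition subpattern :: "'d pattern \<Rightarrow> 'd pattern \<Rightarrow> bool" where
  "subpattern \<alpha> x \<longleftrightarrow>
     (\<exists>p q. wf_pat p \<and> wf_pat q \<and> adjacent p \<alpha> \<and> adjacent \<alpha> q \<and> x = p \<cdot> \<alpha> \<cdot> q)"

definition inner_subpattern :: "'d pattern \<Rightarrow> 'd pattern \<Rightarrow> bool" where
  "inner_subpattern \<beta> u \<longleftrightarrow>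
     (\<exists>p q. wf_pat p \<and> wf_pat q \<and> word p \<noteq> [] \<and> word q \<noteq> [] \<and>
            adjacent p \<beta> \<and> adjacent \<beta> q \<and> u = p \<cdot> \<beta> \<cdot> q)"

definition proper_prefix :: "'d pattern \<Rightarrow> 'd pattern \<Rightarrow> bool" where
  "proper_prefix \<alpha> \<beta> \<longleftrightarrow> (\<exists>q. wf_pat q \<and> word q \<noteq> [] \<and> adjacent \<alpha> q \<and> \<beta> = \<alpha> \<cdot> q)"

definition pat_suffix :: "'d pattern \<Rightarrow> 'd pattern \<Rightarrow> bool" where
  "pat_suffix \<alpha> \<beta> \<longleftrightarrow> (\<exists>p. wf_pat p \<and> adjacent p \<alpha> \<and> \<beta> = p \<cdot> \<alpha>)"

text \<open>\<open>\<langle>\<alpha>|\<beta>|\<gamma>\<rangle>\<close>\<close>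

definition bracket :: "'d pattern \<Rightarrow> 'd pattern \<Rightarrow> 'd pattern \<Rightarrow> 'd pattern set" where
  "bracket \<alpha> \<beta> \<gamma> = {u. wf_pat u \<and> inner_subpattern \<beta> u \<and> subpattern u (\<alpha> \<cdot> \<beta> \<cdot> \<gamma>)}"

text \<open>\<open>\<Pi>\<degree>\<close>\<close>

definition word_patterns :: "'d set \<Rightarrow> nat \<Rightarrow> 'd list set \<Rightarrow> 'd pattern set" where
  "word_patterns D n \<Gamma> = {p \<in> patterns D n. word p \<in> \<Gamma>}"

text \<open>\<open>f(x)\<close>, also applied to patterns \<open>x\<close> that are not full labelings\<close>

definition energy ::
    "'d set \<Rightarrow> nat \<Rightarrow> 'd list set \<Rightarrow> ('d pattern \<Rightarrow> real) \<Rightarrow> 'd pattern \<Rightarrow> real" where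
  "energy D n \<Gamma> c x = (\<Sum>\<alpha> | \<alpha> \<in> word_patterns D n \<Gamma> \<and> subpattern \<alpha> x. c \<alpha>)"

text \<open>The set written \<open>\<Pi>\<close> with a tilde: the five factors of the labeling are \<open>x, \<alpha>, \<beta>, \<gamma>, y\<close>.\<close>

definition required_patterns :: "'d set \<Rightarrow> nat \<Rightarrow> 'd list set \<Rightarrow> 'd pattern set" where
  "required_patterns D n \<Gamma> =
     {\<beta> \<in> patterns D n. \<exists>x \<in> patterns D n. \<exists>\<alpha> \<in> patterns D n. \<exists>\<gamma> \<in> patterns D n. \<exists>y \<in> patterns D n.
        adjacent x \<alpha> \<and> adjacent \<alpha> \<beta> \<and> adjacent \<beta> \<gamma> \<and> adjacent \<gamma> y \<and>
        x \<cdot> \<alpha> \<cdot> \<beta> \<cdot> \<gamma> \<cdot> y \<in> labelings D n 1 n \<and>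
        \<alpha> \<cdot> \<beta> \<in> word_patterns D n \<Gamma> \<and> \<beta> \<cdot> \<gamma> \<in> word_patterns D n \<Gamma> \<and>
        bracket (x \<cdot> \<alpha>) \<beta> (\<gamma> \<cdot> y) \<inter> word_patterns D n \<Gamma> = {}}"

definition ending_at :: "'d pattern set \<Rightarrow> nat \<Rightarrow> 'd pattern set" where
  "ending_at \<Pi> s = {\<alpha> \<in> \<Pi>. hi \<alpha> = s}"

definition strict_suffix :: "'d pattern \<Rightarrow> 'd pattern \<Rightarrow> bool" where
  "strict_suffix \<alpha> \<beta> \<longleftrightarrow> pat_suffix \<alpha> \<beta> \<and> \<alpha> \<noteq> \<beta>"

definition hasse_edges :: "'d pattern set \<Rightarrow> ('d pattern \<times> 'd pattern) set" where
  "hasse_edges S = {(\<alpha>, \<beta>). \<alpha> \<in> S \<and> \<beta> \<in> S \<and> strict_suffix \<alpha> \<beta> \<and>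
     \<not> (\<exists>\<gamma> \<in> S. strict_suffix \<alpha> \<gamma> \<and> strict_suffix \<gamma> \<beta>)}"

text \<open>\<open>\<alpha>\<^sup>\<leftarrow>\<close>, with \<open>None\<close> for "undefined"\<close>

definition left_pat :: "'d pattern set \<Rightarrow> 'd pattern \<Rightarrow> 'd pattern option" where
  "left_pat \<Pi> \<alpha> =
     (if \<exists>\<beta> \<in> \<Pi>. proper_prefix \<beta> \<alpha>
      then Some (ARG_MAX (\<lambda>\<beta>. length (word \<beta>)) \<beta>. \<beta> \<in> \<Pi> \<and> proper_prefix \<beta> \<alpha>)
      else None)"

text \<open>
  A traversal of the Hasse diagram of \<open>S\<close> starting from the leaves: every node is visited once,
  after all of its children.
\<close>

definition leaves_first :: "'d pattern set \<Rightarrow> 'd pattern list \<Rightarrow> bool" where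
  "leaves_first S \<alpha>s \<longleftrightarrow> distinct \<alpha>s \<and> set \<alpha>s = S \<and>
     (\<forall>i < length \<alpha>s. \<forall>j < length \<alpha>s. (\<alpha>s ! i, \<alpha>s ! j) \<in> hasse_edges S \<longrightarrow> j < i)"

text \<open>
  The state of the algorithm is the table \<open>M s \<alpha>\<close>. The argument \<open>f\<close> is the energy function. The
  minimum over children is taken with \<open>INF\<close> on \<open>ereal\<close>, which is \<open>\<infinity>\<close> on the empty set and the
  minimum on a nonempty finite one.
\<close>

definition visit ::
    "'d pattern set \<Rightarrow> ('d pattern \<Rightarrow> real) \<Rightarrow> nat \<Rightarrow> 'd pattern \<Rightarrow>
     (nat \<Rightarrow> 'd pattern \<Rightarrow> ereal) \<Rightarrow> nat \<Rightarrow> 'd pattern \<Rightarrow> ereal" where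
  "visit \<Pi> f s \<alpha> M = M(s := (M s)(\<alpha> :=
     min (case left_pat \<Pi> \<alpha> of
            None \<Rightarrow> \<infinity>
          | Some \<alpha>' \<Rightarrow> M (hi \<alpha>') \<alpha>' + ereal (f \<alpha> - f \<alpha>'))
         (INF \<beta> \<in> {\<beta>. (\<alpha>, \<beta>) \<in> hasse_edges (ending_at \<Pi> s)}. M s \<beta>)))"

definition initial_table :: "nat \<Rightarrow> 'd pattern \<Rightarrow> ereal" where
  "initial_table = (\<lambda>s \<alpha>. if s = 0 \<and> \<alpha> = empty_pat 0 then 0 else undefined)"

text \<open>\<open>ord s\<close> is the order in which the nodes of \<open>\<Pi>\<^sub>s\<close> are visited.\<close>

definition final_table ::
    "nat \<Rightarrow> 'd pattern set \<Rightarrow> ('d pattern \<Rightarrow> real) \<Rightarrow> (nat \<Rightarrow> 'd pattern list) \<Rightarrow>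
     nat \<Rightarrow> 'd pattern \<Rightarrow> ereal" where
  "final_table n \<Pi> f ord =
     fold (\<lambda>s M. fold (visit \<Pi> f s) (ord s) M) [1..<Suc n] initial_table"

definition algorithm_output ::
    "nat \<Rightarrow> 'd pattern set \<Rightarrow> ('d pattern \<Rightarrow> real) \<Rightarrow> (nat \<Rightarrow> 'd pattern list) \<Rightarrow> ereal" where
  "algorithm_output n \<Pi> f ord = (INF \<alpha> \<in> ending_at \<Pi> n. final_table n \<Pi> f ord n \<alpha>)"

text \<open>Every finite set of patterns can be traversed, e.g. by decreasing length.\<close>

lemma leaves_first_exists:
  assumes "finite S"
  shows "\<exists>\<alpha>s. leaves_first S \<alpha>s"
proof -
  obtain xs where xs: "set xs = S" "distinct xs"
    using finite_distinct_list[OF assms] by blast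
  define ys where "ys = rev (sort_key (\<lambda>\<alpha>. length (word \<alpha>)) xs)"
  have dist: "distinct ys" and set: "set ys = S"
    using xs by (auto simp: ys_def)
  have sorted: "sorted (rev (map (\<lambda>\<alpha>. length (word \<alpha>)) ys))"
    by (simp add: ys_def rev_map)
  have "j < i" if i: "i < length ys" and j: "j < length ys"
    and e: "(ys ! i, ys ! j) \<in> hasse_edges S" for i j
  proof (rule ccontr)
    assume "\<not> j < i"
    then have "length (word (ys ! j)) \<le> length (word (ys ! i))"
      using sorted_rev_nth_mono[OF sorted, of i j] i j by simp
    moreover have "strict_suffix (ys ! i) (ys ! j)"
      using e by (simp add: hasse_edges_def)
    then obtain p where p: "wf_pat p" "adjacent p (ys ! i)" "ys ! j = p \<cdot> ys ! i"
      and neq: "ys ! i \<noteq> ys ! j"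
      by (auto simp: strict_suffix_def pat_suffix_def)
    ultimately have "word p = []"
      by (simp add: cat_def)
    with p have "ys ! j = ys ! i"
      by (cases "ys ! i") (simp add: cat_def wf_pat_def adjacent_def)
    with neq show False by simp
  qed
  with dist set show ?thesis
    unfolding leaves_first_def by blast
qed

end

theory Submission
  imports Defs
begin

text \<open>
  Every table entry \<open>M\<^sub>s(\<alpha>)\<close> is at least the minimal energy of a labeling of \<open>[1,s]\<close> ending in
  \<open>\<alpha>\<close>: prolonging a labeling ending in \<open>\<alpha>\<^sup>\<leftarrow>\<close> to one ending in \<open>\<alpha>\<close> adds all the occurrences counted by
  \<open>\<psi>(\<alpha>)\<close> and possibly further ones, whose costs are nonpositive. Conversely, filling the
  positions of a labeling that no occurrence covers with a one-letter word does not increase the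
  energy, so every position may be assumed covered. The inclusion-maximal occurrences in such a
  labeling then form a chain whose members and successive overlaps are all required patterns, and
  following this chain the algorithm collects exactly the energy of the labeling.
\<close>

section \<open>Factors of a sequence\<close>

text \<open>Keeps \<open>[i..<Suc j]\<close> in one piece; the default rule would split off its last
  element.\<close>

declare upt_Suc [simp del]

text \<open>Reading patterns off a total function \<open>g\<close> turns concatenation, subpatterns,
  prefixes and suffixes into statements about intervals. Values of \<open>g\<close> outside
  \<open>{i..j}\<close> are irrelevant, and \<open>i = j + 1\<close> gives an empty pattern.\<close>

definition factor :: "(nat \<Rightarrow> 'd) \<Rightarrow> nat \<Rightarrow> nat \<Rightarrow> 'd pattern" where
  "factor g i j = Pat i j (map g [i..<Suc j])"

lemma factor_sel [simp]:
  "lo (factor g i j) = i" "hi (factor g i j) = j" "word (factor g i j) = map g [i..<Suc j]"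
  by (simp_all add: factor_def)

lemma factor_eq_iff [simp]:
  "factor g i j = factor h k l \<longleftrightarrow> i = k \<and> j = l \<and> (\<forall>m \<in> {i..j}. g m = h m)"
  by (auto simp: factor_def)

lemma wf_factor_iff: "wf_pat (factor g i j) \<longleftrightarrow> 1 \<le> i \<and> i \<le> j + 1"
  by (auto simp: wf_pat_def)

lemma factor_in_patterns_iff:
  "factor g i j \<in> patterns D n \<longleftrightarrow> 1 \<le> i \<and> i \<le> j + 1 \<and> j \<le> n \<and> g ` {i..j} \<subseteq> D"
  by (auto simp: patterns_def wf_factor_iff atLeastLessThanSuc_atLeastAtMost)

lemma wf_pat_eq_factor:
  assumes "wf_pat p"
  shows "p = factor (\<lambda>k. word p ! (k - lo p)) (lo p) (hi p)"
  using assms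
  by (cases p) (auto simp: factor_def wf_pat_def intro!: nth_equalityI)

text \<open>The separate variable \<open>l\<close> lets the rule match both \<open>h\<close>
  followed by \<open>h + 1\<close> and \<open>i - 1\<close> followed by \<open>i\<close>. Either
  part may be empty.\<close>

lemma factor_cat:
  assumes "i \<le> Suc j" "j \<le> k" "l = Suc j"
  shows "factor g i j \<cdot> factor g l k = factor g i k"
proof -
  have "[i..<Suc k] = [i..<Suc j] @ [Suc j..<Suc k]"
    using assms by (metis le_Suc_ex Suc_le_mono add_Suc upt_add_eq_append)
  then show ?thesis
    using assms by (simp add: cat_def factor_def)
qed

lemma append_eq_map_uptD:
  assumes "us @ vs @ ws = map g [i..<k]"
  shows "vs = map g [i + length us..<i + length us + length vs]"
proof -
  have len: "length us + length vs + length ws = k - i"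
    using arg_cong[OF assms, of length] by simp
  show ?thesis
  proof (rule nth_equalityI)
    fix m assume m: "m < length vs"
    have "vs ! m = (us @ vs @ ws) ! (length us + m)"
      using m by (simp add: nth_append)
    also have "\<dots> = g (i + (length us + m))"
      using m len unfolding assms by simp
    finally show "vs ! m = map g [i + length us..<i + length us + length vs] ! m"
      using m by (simp add: add.assoc)
  qed simp
qed

text \<open>The flanks \<open>p\<close> and \<open>q\<close> are well-formed, so adjacency
  determines both ends of \<alpha>; counting letters then yields the well-formedness of \<alpha>
  itself, which is not assumed.\<close>

lemma cat3_eq_factorD:
  assumes "wf_pat p" "wf_pat q" "adjacent p \<alpha>" "adjacent \<alpha> q"
    and eq: "p \<cdot> \<alpha> \<cdot> q = factor g i j" and "i \<le> j + 1"
  shows "lo p = i" "hi q = j" "lo \<alpha> = i + length (word p)" "hi \<alpha> + length (word q) = j"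
    "lo \<alpha> \<le> hi \<alpha> + 1" "\<alpha> = factor g (lo \<alpha>) (hi \<alpha>)"
proof -
  have ends: "lo p = i" "hi q = j"
    and w: "word p @ word \<alpha> @ word q = map g [i..<Suc j]"
    using eq by (simp_all add: cat_def factor_def)
  have len: "length (word p) + length (word \<alpha>) + length (word q) = Suc j - i"
    using arg_cong[OF w, of length] by simp
  have lo: "lo \<alpha> = i + length (word p)"
    and hi: "hi \<alpha> + length (word q) = j"
    using assms ends by (auto simp: wf_pat_def adjacent_def)
  have hi': "Suc (hi \<alpha>) = lo \<alpha> + length (word \<alpha>)"
    using lo hi len \<open>i \<le> j + 1\<close> by linarith
  have "word \<alpha> = map g [lo \<alpha>..<Suc (hi \<alpha>)]"
    using append_eq_map_uptD[OF w] unfolding hi' lo .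
  then show "\<alpha> = factor g (lo \<alpha>) (hi \<alpha>)"
    unfolding factor_def by (cases \<alpha>) simp
  show "lo p = i" "hi q = j" "lo \<alpha> = i + length (word p)" "hi \<alpha> + length (word q) = j"
    "lo \<alpha> \<le> hi \<alpha> + 1"
    using ends lo hi hi' by simp_all
qed

section \<open>Subpatterns, prefixes and suffixes of a factor as subintervals\<close>

lemma subpattern_factor_iff:
  assumes "1 \<le> i" "i \<le> j + 1"
  shows "subpattern \<alpha> (factor g i j) \<longleftrightarrow>
    i \<le> lo \<alpha> \<and> lo \<alpha> \<le> hi \<alpha> + 1 \<and> hi \<alpha> \<le> j \<and> \<alpha> = factor g (lo \<alpha>) (hi \<alpha>)"
    (is "?L \<longleftrightarrow> ?R")
proof
  assume ?L
  then obtain p q where pq: "wf_pat p" "wf_pat q" "adjacent p \<alpha>" "adjacent \<alpha> q"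
    "p \<cdot> \<alpha> \<cdot> q = factor g i j"
    by (auto simp: subpattern_def)
  show ?R
    using cat3_eq_factorD[OF pq \<open>i \<le> j + 1\<close>] by (metis le_add1)
next
  assume R: ?R
  define a b where "a = lo \<alpha>" and "b = hi \<alpha>"
  have \<alpha>: "\<alpha> = factor g a b" and ab: "i \<le> a" "a \<le> b + 1" "b \<le> j"
    using R by (simp_all add: a_def b_def)
  \<comment> \<open>Since \<open>a\<close> is positive, \<open>a - 1\<close> is a genuine
    predecessor; a flank is empty when \<alpha> touches that end.\<close>
  have "factor g i j = factor g i (a - 1) \<cdot> \<alpha> \<cdot> factor g (b + 1) j"
    using assms ab by (simp add: \<alpha> factor_cat)
  moreover have "wf_pat (factor g i (a - 1))" "wf_pat (factor g (b + 1) j)"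
    using assms ab by (simp_all add: wf_factor_iff)
  moreover have "adjacent (factor g i (a - 1)) \<alpha>" "adjacent \<alpha> (factor g (b + 1) j)"
    using assms ab by (simp_all add: \<alpha> adjacent_def)
  ultimately show ?L
    unfolding subpattern_def by blast
qed

lemma inner_subpattern_factorD:
  assumes "inner_subpattern \<beta> (factor g i j)" "i \<le> j + 1"
  shows "i < lo \<beta>" "hi \<beta> < j"
proof -
  obtain p q where pq: "wf_pat p" "wf_pat q" "adjacent p \<beta>" "adjacent \<beta> q"
    "p \<cdot> \<beta> \<cdot> q = factor g i j" and "word p \<noteq> []" "word q \<noteq> []"
    using assms by (auto simp: inner_subpattern_def)
  with cat3_eq_factorD[OF pq assms(2)] show "i < lo \<beta>" "hi \<beta> < j"
    by (metis length_greater_0_conv less_add_same_cancel1)+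
qed

lemma proper_prefix_factor_iff:
  assumes "i \<le> j + 1"
  shows "proper_prefix \<alpha> (factor g i j) \<longleftrightarrow>
    lo \<alpha> = i \<and> i \<le> hi \<alpha> + 1 \<and> hi \<alpha> < j \<and> \<alpha> = factor g i (hi \<alpha>)" (is "?L \<longleftrightarrow> ?R")
proof
  assume ?L
  then obtain q where q: "wf_pat q" "word q \<noteq> []" "adjacent \<alpha> q" "factor g i j = \<alpha> \<cdot> q"
    by (auto simp: proper_prefix_def)
  have ends: "lo \<alpha> = i" "hi q = j" and w: "[] @ word \<alpha> @ word q = map g [i..<Suc j]"
    using q(4) by (auto simp: cat_def factor_def)
  have len: "length (word \<alpha>) + length (word q) = Suc j - i"
    using arg_cong[OF w, of length] by simp
  have hi: "hi \<alpha> + length (word q) = j"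
    using q ends by (auto simp: wf_pat_def adjacent_def)
  have hi': "Suc (hi \<alpha>) = i + length (word \<alpha>)"
    using hi len assms by linarith
  have "word \<alpha> = map g [i..<Suc (hi \<alpha>)]"
    using append_eq_map_uptD[OF w] unfolding hi' by simp
  then have "\<alpha> = factor g i (hi \<alpha>)"
    using ends unfolding factor_def by (cases \<alpha>) simp
  then show ?R
    using ends hi hi' q(2) by (metis Suc_eq_plus1 le_add1 length_greater_0_conv less_add_same_cancel1)
next
  assume R: ?R
  define b where "b = hi \<alpha>"
  have "\<alpha> = factor g i b" "i \<le> b + 1" "b < j"
    using R by (simp_all add: b_def)
  moreover from this have "factor g i j = \<alpha> \<cdot> factor g (b + 1) j"
    by (simp add: factor_cat)
  ultimately show ?L
    unfolding proper_prefix_def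
    by (intro exI[of _ "factor g (b + 1) j"]) (simp add: wf_factor_iff adjacent_def)
qed

lemma pat_suffix_factor_iff:
  assumes "1 \<le> i" "i \<le> j + 1"
  shows "pat_suffix \<alpha> (factor g i j) \<longleftrightarrow>
    i \<le> lo \<alpha> \<and> lo \<alpha> \<le> j + 1 \<and> hi \<alpha> = j \<and> \<alpha> = factor g (lo \<alpha>) j" (is "?L \<longleftrightarrow> ?R")
proof
  assume ?L
  then obtain p where p: "wf_pat p" "adjacent p \<alpha>" "factor g i j = p \<cdot> \<alpha>"
    by (auto simp: pat_suffix_def)
  have ends: "lo p = i" "hi \<alpha> = j" and w: "word p @ word \<alpha> @ [] = map g [i..<Suc j]"
    using p(3) by (auto simp: cat_def factor_def)
  have len: "length (word p) + length (word \<alpha>) = Suc j - i"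
    using arg_cong[OF w, of length] by simp
  have lo: "lo \<alpha> = i + length (word p)"
    using p ends by (auto simp: wf_pat_def adjacent_def)
  have hi: "Suc j = lo \<alpha> + length (word \<alpha>)"
    using lo len assms by linarith
  have "word \<alpha> = map g [lo \<alpha>..<Suc j]"
    using append_eq_map_uptD[OF w] unfolding hi lo .
  then have "\<alpha> = factor g (lo \<alpha>) j"
    using ends unfolding factor_def by (cases \<alpha>) simp
  then show ?R
    using ends hi lo by simp
next
  assume R: ?R
  define a where "a = lo \<alpha>"
  have "\<alpha> = factor g a j" "i \<le> a" "a \<le> j + 1"
    using R by (simp_all add: a_def)
  moreover from this have "factor g i j = factor g i (a - 1) \<cdot> \<alpha>"
    using assms by (simp add: factor_cat)
  ultimately show ?L
    using assms unfolding pat_suffix_def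
    by (intro exI[of _ "factor g i (a - 1)"]) (simp add: wf_factor_iff adjacent_def)
qed

lemma strict_suffix_factor_iff:
  assumes "1 \<le> i" "i \<le> j + 1"
  shows "strict_suffix \<alpha> (factor g i j) \<longleftrightarrow>
    i < lo \<alpha> \<and> lo \<alpha> \<le> j + 1 \<and> hi \<alpha> = j \<and> \<alpha> = factor g (lo \<alpha>) j"
  unfolding strict_suffix_def pat_suffix_factor_iff[OF assms]
  by (metis factor_sel(1) nat_less_le)

lemma finite_labelings:
  assumes "finite D"
  shows "finite (labelings D n i j)"
proof (rule finite_subset)
  show "labelings D n i j \<subseteq> Pat i j ` {w. set w \<subseteq> D \<and> length w = j + 1 - i}"
  proof
    fix p assume "p \<in> labelings D n i j"
    then show "p \<in> Pat i j ` {w. set w \<subseteq> D \<and> length w = j + 1 - i}"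
      by (cases p) (auto simp: labelings_def patterns_def wf_pat_def)
  qed
  show "finite (Pat i j ` {w. set w \<subseteq> D \<and> length w = j + 1 - i})"
    using assms by (simp add: finite_lists_length_eq)
qed

section \<open>The recursion satisfied by the computed table\<close>

lemma left_pat_SomeD:
  assumes "left_pat \<Pi> \<alpha> = Some \<beta>"
  shows "\<beta> \<in> \<Pi>" "proper_prefix \<beta> \<alpha>"
proof -
  obtain \<gamma> where \<gamma>: "\<gamma> \<in> \<Pi> \<and> proper_prefix \<gamma> \<alpha>"
    and \<beta>: "\<beta> = (ARG_MAX (\<lambda>\<beta>. length (word \<beta>)) \<beta>. \<beta> \<in> \<Pi> \<and> proper_prefix \<beta> \<alpha>)"
    using assms by (auto simp: left_pat_def split: if_splits)
  have "\<beta> \<in> \<Pi> \<and> proper_prefix \<beta> \<alpha>"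
    unfolding \<beta>
    \<comment> \<open>\<open>ARG_MAX\<close> is attained because the lengths of proper prefixes are
      bounded by that of \<alpha>.\<close>
    by (rule arg_max_natI[where k = \<gamma> and b = "Suc (length (word \<alpha>))"], rule \<gamma>)
      (auto simp: proper_prefix_def cat_def)
  then show "\<beta> \<in> \<Pi>" "proper_prefix \<beta> \<alpha>" by simp_all
qed

lemma left_pat_longest:
  assumes "\<gamma> \<in> \<Pi>" "proper_prefix \<gamma> \<alpha>"
  obtains \<beta> where "left_pat \<Pi> \<alpha> = Some \<beta>" "length (word \<gamma>) \<le> length (word \<beta>)"
proof
  show "left_pat \<Pi> \<alpha> =
      Some (ARG_MAX (\<lambda>\<beta>. length (word \<beta>)) \<beta>. \<beta> \<in> \<Pi> \<and> proper_prefix \<beta> \<alpha>)"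
    using assms by (auto simp: left_pat_def)
  show "length (word \<gamma>) \<le>
      length (word (ARG_MAX (\<lambda>\<beta>. length (word \<beta>)) \<beta>. \<beta> \<in> \<Pi> \<and> proper_prefix \<beta> \<alpha>))"
    by (rule arg_max_nat_le[where b = "Suc (length (word \<alpha>))"], rule conjI[OF assms])
      (auto simp: proper_prefix_def cat_def)
qed

lemma proper_prefix_hi_less: "proper_prefix \<alpha> \<beta> \<Longrightarrow> hi \<alpha> < hi \<beta>"
  by (auto simp: proper_prefix_def wf_pat_def adjacent_def cat_def neq_Nil_conv)

section \<open>Effect of the visits on the table\<close>

lemma fold_visit_other_row: "t \<noteq> s \<Longrightarrow> fold (visit \<Pi> f s) xs M t = M t"
  by (induction xs arbitrary: M) (simp_all add: visit_def)

lemma fold_visit_unvisited: "\<beta> \<notin> set xs \<Longrightarrow> fold (visit \<Pi> f s) xs M s \<beta> = M s \<beta>"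
  by (induction xs arbitrary: M) (simp_all add: visit_def)

text \<open>When \<alpha> is visited, its children already have their final values and
  \<open>left_pat\<close> points into an earlier row. No later visit of the pass changes these
  entries or that of \<alpha>, so the assignment holds as an equation for the table after the
  pass.\<close>

lemma fold_visit_eq:
  assumes order: "leaves_first (ending_at \<Pi> s) xs" and \<alpha>: "\<alpha> \<in> ending_at \<Pi> s"
    and T: "T = fold (visit \<Pi> f s) xs M"
  shows "T s \<alpha> =
     min (case left_pat \<Pi> \<alpha> of None \<Rightarrow> \<infinity> | Some \<alpha>' \<Rightarrow> T (hi \<alpha>') \<alpha>' + ereal (f \<alpha> - f \<alpha>'))
         (INF \<beta> \<in> {\<beta>. (\<alpha>, \<beta>) \<in> hasse_edges (ending_at \<Pi> s)}. T s \<beta>)"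
proof -
  have dist: "distinct xs" and set: "set xs = ending_at \<Pi> s"
    using order by (simp_all add: leaves_first_def)
  obtain i where i: "i < length xs" "xs ! i = \<alpha>"
    using \<alpha> set by (metis in_set_conv_nth)
  \<comment> \<open>The nodes visited before and after \<alpha>.\<close>
  define ys zs where "ys = take i xs" and "zs = drop (Suc i) xs"
  have xs: "xs = ys @ \<alpha> # zs"
    using i id_take_nth_drop[of i xs] by (simp add: ys_def zs_def)
  define M' where "M' = fold (visit \<Pi> f s) ys M"
  have T': "T = fold (visit \<Pi> f s) zs (visit \<Pi> f s \<alpha> M')"
    by (simp add: T xs M'_def)
  have "T s \<alpha> = visit \<Pi> f s \<alpha> M' s \<alpha>"
    using dist unfolding T' xs by (simp add: fold_visit_unvisited)
  also have "\<dots> = min (case left_pat \<Pi> \<alpha> of None \<Rightarrow> \<infinity>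
        | Some \<alpha>' \<Rightarrow> M' (hi \<alpha>') \<alpha>' + ereal (f \<alpha> - f \<alpha>'))
      (INF \<beta> \<in> {\<beta>. (\<alpha>, \<beta>) \<in> hasse_edges (ending_at \<Pi> s)}. M' s \<beta>)"
    by (simp add: visit_def)
  also have "(INF \<beta> \<in> {\<beta>. (\<alpha>, \<beta>) \<in> hasse_edges (ending_at \<Pi> s)}. M' s \<beta>) =
      (INF \<beta> \<in> {\<beta>. (\<alpha>, \<beta>) \<in> hasse_edges (ending_at \<Pi> s)}. T s \<beta>)"
  proof (rule INF_cong)
    fix \<beta> assume "\<beta> \<in> {\<beta>. (\<alpha>, \<beta>) \<in> hasse_edges (ending_at \<Pi> s)}"
    then have edge: "(\<alpha>, \<beta>) \<in> hasse_edges (ending_at \<Pi> s)" and "\<beta> \<in> set xs"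
      by (auto simp: hasse_edges_def set)
    then obtain j where j: "j < length xs" "xs ! j = \<beta>"
      by (metis in_set_conv_nth)
    have "j < i"
      using order edge i j unfolding leaves_first_def by metis
    \<comment> \<open>A child precedes \<alpha> in the order, and by distinctness it is not visited
      again.\<close>
    then have "\<beta> \<in> set ys"
      using i j by (auto simp: ys_def in_set_conv_nth intro!: exI[of _ j])
    then have "\<beta> \<notin> set zs" "\<beta> \<noteq> \<alpha>"
      using dist unfolding xs by auto
    then show "M' s \<beta> = T s \<beta>"
      by (simp add: T' fold_visit_unvisited) (simp add: visit_def)
  qed simp
  also have "(case left_pat \<Pi> \<alpha> of None \<Rightarrow> \<infinity>
        | Some \<alpha>' \<Rightarrow> M' (hi \<alpha>') \<alpha>' + ereal (f \<alpha> - f \<alpha>')) =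
      (case left_pat \<Pi> \<alpha> of None \<Rightarrow> \<infinity>
        | Some \<alpha>' \<Rightarrow> T (hi \<alpha>') \<alpha>' + ereal (f \<alpha> - f \<alpha>'))"
  proof (cases "left_pat \<Pi> \<alpha>")
    case (Some \<alpha>')
    then have "hi \<alpha>' < s"
      using proper_prefix_hi_less[OF left_pat_SomeD(2)] \<alpha> by (auto simp: ending_at_def)
    then show ?thesis
      by (simp add: Some T M'_def fold_visit_other_row)
  qed simp
  finally show ?thesis .
qed

lemma fold_rows_other:
  assumes "t \<notin> set ss"
  shows "fold (\<lambda>s M. fold (visit \<Pi> f s) (ord s) M) ss M t = M t"
  using assms by (induction ss arbitrary: M) (simp_all add: fold_visit_other_row)

text \<open>The passes start with \<open>s = 1\<close>, so row 0 keeps its initial value.\<close>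

lemma final_table_zero: "final_table n \<Pi> f ord 0 (empty_pat 0) = 0"
  by (simp add: final_table_def fold_rows_other initial_table_def)

text \<open>Passes after the one for \<open>s\<close> write only to rows beyond \<open>s\<close>, so
  the equation valid after pass \<open>s\<close> survives to the end.\<close>

lemma final_table_eq:
  fixes T :: "nat \<Rightarrow> 'd pattern \<Rightarrow> ereal"
  assumes s: "s \<in> {1..n}" and order: "leaves_first (ending_at \<Pi> s) (ord s)"
    and \<alpha>: "\<alpha> \<in> ending_at \<Pi> s" and T: "T = final_table n \<Pi> f ord"
  shows "T s \<alpha> =
     min (case left_pat \<Pi> \<alpha> of None \<Rightarrow> \<infinity> | Some \<alpha>' \<Rightarrow> T (hi \<alpha>') \<alpha>' + ereal (f \<alpha> - f \<alpha>'))
         (INF \<beta> \<in> {\<beta>. (\<alpha>, \<beta>) \<in> hasse_edges (ending_at \<Pi> s)}. T s \<beta>)"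
proof -
  have "[1..<Suc n] = [1..<s] @ s # [Suc s..<Suc n]"
    using s upt_add_eq_append[of 1 s "Suc n - s"] by (simp add: upt_conv_Cons)
  then have T_split: "T = fold (\<lambda>s M. fold (visit \<Pi> f s) (ord s) M) [Suc s..<Suc n]
      (fold (visit \<Pi> f s) (ord s)
        (fold (\<lambda>s M. fold (visit \<Pi> f s) (ord s) M) [1..<s] initial_table))"
    unfolding T final_table_def by simp
  \<comment> \<open>The table right after pass \<open>s\<close>.\<close>
  define U where "U = fold (visit \<Pi> f s) (ord s)
        (fold (\<lambda>s M. fold (visit \<Pi> f s) (ord s) M) [1..<s] initial_table)"
  have rows: "T t = U t" if "t \<le> s" for t
    unfolding T_split U_def using that by (intro fold_rows_other) simp
  have "(case left_pat \<Pi> \<alpha> of None \<Rightarrow> \<infinity>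
        | Some \<alpha>' \<Rightarrow> T (hi \<alpha>') \<alpha>' + ereal (f \<alpha> - f \<alpha>')) =
      (case left_pat \<Pi> \<alpha> of None \<Rightarrow> \<infinity>
        | Some \<alpha>' \<Rightarrow> U (hi \<alpha>') \<alpha>' + ereal (f \<alpha> - f \<alpha>'))"
  proof (cases "left_pat \<Pi> \<alpha>")
    case (Some \<alpha>')
    then have "hi \<alpha>' \<le> s"
      using proper_prefix_hi_less[OF left_pat_SomeD(2)[OF Some]] \<alpha> by (simp add: ending_at_def)
    then show ?thesis
      by (simp add: Some rows)
  qed simp
  then show ?thesis
    using fold_visit_eq[OF order \<alpha> U_def] by (simp add: rows)
qed

section \<open>Correctness\<close>

locale pattern_minimization =
  fixes D :: "'d set" and n :: nat and \<Gamma> :: "'d list set"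
    and c :: "'d pattern \<Rightarrow> real" and \<Pi> :: "'d pattern set"
    and ord :: "nat \<Rightarrow> 'd pattern list"
  assumes finite_D: "finite D" and n_pos: "n \<ge> 1"
    and words: "\<forall>w \<in> \<Gamma>. w \<noteq> [] \<and> set w \<subseteq> D"
    and c_nonpos: "\<forall>\<alpha> \<in> word_patterns D n \<Gamma>. c \<alpha> \<le> 0"
    and singleton_word: "\<exists>w \<in> \<Gamma>. length w = 1"
    and \<Pi>_patterns: "\<Pi> \<subseteq> patterns D n"
    and \<Pi>_zero: "ending_at \<Pi> 0 = {empty_pat 0}"
    and \<Pi>_required: "required_patterns D n \<Gamma> \<subseteq> \<Pi>"
    and order: "\<forall>s \<in> {1..n}. leaves_first (ending_at \<Pi> s) (ord s)"
begin

section \<open>Occurrences and the energy of a factor\<close>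

abbreviation f :: "'d pattern \<Rightarrow> real" where
  "f \<equiv> energy D n \<Gamma> c"

abbreviation T :: "nat \<Rightarrow> 'd pattern \<Rightarrow> ereal" where
  "T \<equiv> final_table n \<Pi> f ord"

text \<open>Representing an occurrence by its two ends makes energies sums over pairs of positions,
  which can be compared for different intervals of the same \<open>g\<close>.\<close>

definition occurs :: "(nat \<Rightarrow> 'd) \<Rightarrow> nat \<Rightarrow> nat \<Rightarrow> bool" where
  "occurs g a b \<longleftrightarrow> factor g a b \<in> word_patterns D n \<Gamma>"

lemma occursD:
  assumes "occurs g a b"
  shows "1 \<le> a" "a \<le> b" "b \<le> n"
proof -
  have "map g [a..<Suc b] \<noteq> []" "factor g a b \<in> patterns D n"
    using assms words unfolding occurs_def word_patterns_def by auto
  then show "1 \<le> a" "a \<le> b" "b \<le> n"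
    by (auto simp: factor_in_patterns_iff)
qed

lemma finite_occurs: "S \<subseteq> {(a, b). occurs g a b} \<Longrightarrow> finite S"
  by (rule finite_subset[of _ "{..n} \<times> {..n}"]) (use occursD in fastforce)+

text \<open>A reindexing of the sum: the map from \<open>(a, b)\<close> to
  \<open>factor g a b\<close> is injective because a pattern carries its ends.\<close>

lemma f_factor:
  assumes "1 \<le> i" "i \<le> j + 1"
  shows "f (factor g i j) =
    (\<Sum>(a, b) \<in> {(a, b). i \<le> a \<and> b \<le> j \<and> occurs g a b}. c (factor g a b))"
proof -
  have "{\<alpha>. \<alpha> \<in> word_patterns D n \<Gamma> \<and> subpattern \<alpha> (factor g i j)} =
      (\<lambda>(a, b). factor g a b) ` {(a, b). i \<le> a \<and> b \<le> j \<and> occurs g a b}" (is "?A = ?h ` ?B")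
  proof
    show "?A \<subseteq> ?h ` ?B"
    proof
      fix \<alpha> assume "\<alpha> \<in> ?A"
      then have "\<alpha> = ?h (lo \<alpha>, hi \<alpha>)" "(lo \<alpha>, hi \<alpha>) \<in> ?B"
        using assms by (auto simp: subpattern_factor_iff occurs_def)
      then show "\<alpha> \<in> ?h ` ?B" by (rule image_eqI)
    qed
    show "?h ` ?B \<subseteq> ?A"
    proof
      fix \<alpha> assume "\<alpha> \<in> ?h ` ?B"
      then obtain a b where "\<alpha> = factor g a b" "i \<le> a" "b \<le> j" "occurs g a b"
        by auto
      then show "\<alpha> \<in> ?A"
        using occursD[of g a b] assms by (simp add: subpattern_factor_iff occurs_def)
    qed
  qed
  moreover have "inj_on (\<lambda>(a, b). factor g a b) {(a, b). i \<le> a \<and> b \<le> j \<and> occurs g a b}"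
    by (auto simp: inj_on_def)
  ultimately show ?thesis
    by (simp add: energy_def sum.reindex case_prod_unfold)
qed

lemma f_empty_factor: "1 \<le> i \<Longrightarrow> f (factor g i (i - 1)) = 0"
  by (subst f_factor) (use occursD in \<open>force intro!: sum.neutral\<close>)+

text \<open>This evaluates \<psi>: the occurrences inside \<open>[i,j]\<close> are split by whether
  they end at or before \<open>k\<close>.\<close>

lemma f_factor_diff:
  assumes "1 \<le> i" "i \<le> k + 1" "k \<le> j"
  shows "f (factor g i j) - f (factor g i k) =
    (\<Sum>(a, b) \<in> {(a, b). i \<le> a \<and> k < b \<and> b \<le> j \<and> occurs g a b}. c (factor g a b))"
proof -
  define A B where "A = {(a, b). i \<le> a \<and> b \<le> k \<and> occurs g a b}"
    and "B = {(a, b). i \<le> a \<and> k < b \<and> b \<le> j \<and> occurs g a b}"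
  have "{(a, b). i \<le> a \<and> b \<le> j \<and> occurs g a b} = A \<union> B"
    using assms by (auto simp: A_def B_def)
  moreover have "A \<inter> B = {}" "finite A" "finite B"
    by (auto simp: A_def B_def intro!: finite_occurs[of _ g])
  moreover have "f (factor g i k) = (\<Sum>(a, b) \<in> A. c (factor g a b))"
    using assms by (simp add: f_factor A_def)
  ultimately show ?thesis
    using assms by (simp add: f_factor sum.union_disjoint flip: B_def)
qed

text \<open>Extending the whole prefix from \<open>k\<close> to \<open>j\<close> gains every
  occurrence counted in the difference for start \<open>i\<close>, and also those starting before
  \<open>i\<close>, whose costs are nonpositive.\<close>

lemma f_extend_le:
  assumes "1 \<le> i" "i \<le> k + 1" "k \<le> j"
  shows "f (factor g 1 j) \<le> f (factor g 1 k) + (f (factor g i j) - f (factor g i k))"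
proof -
  \<comment> \<open>Negated costs are nonnegative, so enlarging the index set can only increase the
    sum.\<close>
  have "- (f (factor g i j) - f (factor g i k)) \<le> - (f (factor g 1 j) - f (factor g 1 k))"
    unfolding f_factor_diff[OF assms] f_factor_diff[OF order_refl le_add2 \<open>k \<le> j\<close>]
      sum_negf[symmetric]
    by (rule sum_mono2[OF finite_occurs[of _ g]])
      (use assms c_nonpos in \<open>auto simp: occurs_def\<close>)
  then show ?thesis by simp
qed

lemma \<Pi>_factorD:
  assumes "\<alpha> \<in> \<Pi>"
  obtains g where "\<alpha> = factor g (lo \<alpha>) (hi \<alpha>)" "g ` {lo \<alpha>..hi \<alpha>} \<subseteq> D"
    "1 \<le> lo \<alpha>" "lo \<alpha> \<le> hi \<alpha> + 1" "hi \<alpha> \<le> n"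
proof -
  have "\<alpha> \<in> patterns D n" using assms \<Pi>_patterns by auto
  moreover define g where "g = (\<lambda>k. word \<alpha> ! (k - lo \<alpha>))"
  moreover have "\<alpha> = factor g (lo \<alpha>) (hi \<alpha>)"
    using \<open>\<alpha> \<in> patterns D n\<close> unfolding g_def by (intro wf_pat_eq_factor) (simp add: patterns_def)
  ultimately show ?thesis
    using that[of g] factor_in_patterns_iff[of g "lo \<alpha>" "hi \<alpha>" D n] by auto
qed

lemma T_eq:
  assumes "\<alpha> \<in> \<Pi>" "s = hi \<alpha>" "1 \<le> s"
  shows "T s \<alpha> =
     min (case left_pat \<Pi> \<alpha> of None \<Rightarrow> \<infinity> | Some \<alpha>' \<Rightarrow> T (hi \<alpha>') \<alpha>' + ereal (f \<alpha> - f \<alpha>'))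
         (INF \<beta> \<in> {\<beta>. (\<alpha>, \<beta>) \<in> hasse_edges (ending_at \<Pi> s)}. T s \<beta>)"
proof -
  have "s \<in> {1..n}"
    using assms \<Pi>_patterns by (auto simp: patterns_def)
  then show ?thesis
    using order assms by (intro final_table_eq) (auto simp: ending_at_def)
qed

subsection \<open>Lower bound\<close>

text \<open>The labelings of \<open>[1, hi \<alpha>]\<close> that end in \<alpha>, given as
  functions whose values beyond \<open>hi \<alpha>\<close> are arbitrary.\<close>

definition completions :: "'d pattern \<Rightarrow> (nat \<Rightarrow> 'd) set" where
  "completions \<alpha> = {g. g ` {1..hi \<alpha>} \<subseteq> D \<and> \<alpha> = factor g (lo \<alpha>) (hi \<alpha>)}"

definition best :: "'d pattern \<Rightarrow> ereal" where
  "best \<alpha> = (INF g \<in> completions \<alpha>. ereal (f (factor g 1 (hi \<alpha>))))"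

text \<open>A labeling ending in \<beta> also ends in its suffix \<alpha>, so the infimum for
  \<beta> ranges over a smaller set.\<close>

lemma best_suffix_mono:
  assumes "\<beta> \<in> \<Pi>" "strict_suffix \<alpha> \<beta>"
  shows "best \<alpha> \<le> best \<beta>" "lo \<beta> < lo \<alpha>" "hi \<beta> = hi \<alpha>"
proof -
  obtain g where \<beta>: "\<beta> = factor g (lo \<beta>) (hi \<beta>)" "1 \<le> lo \<beta>" "lo \<beta> \<le> hi \<beta> + 1"
    using \<Pi>_factorD[OF assms(1)] by metis
  have suf: "strict_suffix \<alpha> (factor h (lo \<beta>) (hi \<beta>)) \<longleftrightarrow>
      lo \<beta> < lo \<alpha> \<and> lo \<alpha> \<le> hi \<beta> + 1 \<and> hi \<alpha> = hi \<beta> \<and> \<alpha> = factor h (lo \<alpha>) (hi \<beta>)" for h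
    using strict_suffix_factor_iff[OF \<beta>(2,3)] .
  show ends: "lo \<beta> < lo \<alpha>" "hi \<beta> = hi \<alpha>"
    using assms(2) suf[of g] \<beta>(1) by auto
  have "completions \<beta> \<subseteq> completions \<alpha>"
  proof
    fix h assume h: "h \<in> completions \<beta>"
    then have "strict_suffix \<alpha> (factor h (lo \<beta>) (hi \<beta>))"
      using assms(2) by (simp add: completions_def)
    then show "h \<in> completions \<alpha>"
      using suf[of h] h ends by (simp add: completions_def)
  qed
  then show "best \<alpha> \<le> best \<beta>"
    unfolding best_def ends(2) by (intro INF_superset_mono) simp_all
qed

lemma best_prefix_le:
  assumes "\<alpha> \<in> \<Pi>" "proper_prefix \<alpha>' \<alpha>"
  shows "best \<alpha> \<le> best \<alpha>' + ereal (f \<alpha> - f \<alpha>')"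
proof -
  define i j k where "i = lo \<alpha>" and "j = hi \<alpha>" and "k = hi \<alpha>'"
  obtain h where \<alpha>: "\<alpha> = factor h i j" and h: "h ` {i..j} \<subseteq> D"
    and ij: "1 \<le> i" "i \<le> j + 1"
    using \<Pi>_factorD[OF assms(1)] unfolding i_def j_def by metis
  have \<alpha>': "\<alpha>' = factor h i k" and k: "i \<le> k + 1" "k < j"
    using assms(2) ij unfolding \<alpha> proper_prefix_factor_iff[OF ij(2)] k_def by auto
  \<comment> \<open>Moving the finite difference to the left leaves a lower bound to be checked for
    each completion of \<open>\<alpha>'\<close> separately.\<close>
  have "best \<alpha> - ereal (f \<alpha> - f \<alpha>') \<le> ereal (f (factor g 1 k))" if g: "g \<in> completions \<alpha>'" for g
  proof -
    \<comment> \<open>The completion of \<open>\<alpha>'\<close> is prolonged by the remaining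
      letters of \<alpha>. Both functions agree on \<open>[i,k]\<close>, so the result ends in
      \<alpha>.\<close>
    define g' where "g' = (\<lambda>m. if m \<le> k then g m else h m)"
    have gh: "g m = h m" if "m \<in> {i..k}" for m
      using g that by (auto simp: completions_def \<alpha>')
    have g': "factor g' i j = \<alpha>" "factor g' i k = \<alpha>'" "factor g' 1 k = factor g 1 k"
      using gh by (auto simp: g'_def \<alpha> \<alpha>')
    have "g' m \<in> D" if "m \<in> {1..j}" for m
    proof (cases "m \<le> k")
      case True
      then show ?thesis using g that by (auto simp: g'_def completions_def \<alpha>')
    next
      case False
      then show ?thesis using h k that by (auto simp: g'_def)
    qed
    then have "g' \<in> completions \<alpha>"
      using g' by (auto simp: completions_def \<alpha>)
    then have "best \<alpha> \<le> ereal (f (factor g' 1 j))"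
      unfolding best_def j_def[symmetric] by (rule INF_lower)
    also have "\<dots> \<le> ereal (f (factor g 1 k) + (f \<alpha> - f \<alpha>'))"
      using f_extend_le[of i k j g'] ij k g' by (simp del: factor_eq_iff)
    finally show ?thesis
      by (simp add: ereal_minus_le_iff add.commute)
  qed
  then have "best \<alpha> - ereal (f \<alpha> - f \<alpha>') \<le> best \<alpha>'"
    unfolding best_def[of \<alpha>'] k_def[symmetric] by (intro INF_greatest)
  then show ?thesis
    by (simp add: ereal_minus_le_iff add.commute)
qed

text \<open>Induction on \<open>lo \<alpha> + hi \<alpha>\<close> serves both branches of the
  recursion: \<open>left_pat\<close> keeps \<open>lo\<close> and lowers \<open>hi\<close>, while a
  child in the Hasse diagram keeps \<open>hi\<close> and lowers \<open>lo\<close>.\<close>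

lemma best_le_T: "\<alpha> \<in> \<Pi> \<Longrightarrow> best \<alpha> \<le> T (hi \<alpha>) \<alpha>"
proof (induction \<alpha> rule: measure_induct_rule[where f = "\<lambda>\<alpha>. lo \<alpha> + hi \<alpha>"])
  case (less \<alpha>)
  show ?case
  proof (cases "hi \<alpha> = 0")
    case True
    then have "\<alpha> = empty_pat 0"
      using \<Pi>_zero less.prems by (auto simp: ending_at_def)
    \<comment> \<open>Over the empty interval every function is a completion, and its energy is
      0.\<close>
    then have "\<alpha> = factor g 1 0" "lo \<alpha> = 1" for g
      by (simp_all add: empty_pat_def factor_def)
    then have "g \<in> completions \<alpha>" for g
      using True by (simp add: completions_def)
    then have "best \<alpha> \<le> ereal (f (factor g 1 0))" for g
      unfolding best_def using True by (intro INF_lower2[of g]) simp_all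
    then show ?thesis
      using f_empty_factor[of 1] True \<open>\<alpha> = empty_pat 0\<close> by (simp add: final_table_zero zero_ereal_def)
  next
    case False
    have "best \<alpha> \<le> (case left_pat \<Pi> \<alpha> of None \<Rightarrow> \<infinity>
        | Some \<alpha>' \<Rightarrow> T (hi \<alpha>') \<alpha>' + ereal (f \<alpha> - f \<alpha>'))"
    proof (cases "left_pat \<Pi> \<alpha>")
      case (Some \<alpha>')
      note \<alpha>' = left_pat_SomeD[OF Some]
      have "lo \<alpha>' = lo \<alpha>"
        using \<alpha>'(2) by (auto simp: proper_prefix_def cat_def)
      then have "best \<alpha>' \<le> T (hi \<alpha>') \<alpha>'"
        using less.IH[OF _ \<alpha>'(1)] proper_prefix_hi_less[OF \<alpha>'(2)] by simp
      then have "best \<alpha>' + ereal (f \<alpha> - f \<alpha>') \<le> T (hi \<alpha>') \<alpha>' + ereal (f \<alpha> - f \<alpha>')"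
        by (rule add_right_mono)
      then show ?thesis
        using best_prefix_le[OF less.prems \<alpha>'(2)] by (simp add: Some)
    qed simp
    moreover have "best \<alpha> \<le>
        (INF \<beta> \<in> {\<beta>. (\<alpha>, \<beta>) \<in> hasse_edges (ending_at \<Pi> (hi \<alpha>))}. T (hi \<alpha>) \<beta>)"
    proof (rule INF_greatest)
      fix \<beta> assume "\<beta> \<in> {\<beta>. (\<alpha>, \<beta>) \<in> hasse_edges (ending_at \<Pi> (hi \<alpha>))}"
      then have \<beta>: "\<beta> \<in> \<Pi>" "strict_suffix \<alpha> \<beta>"
        by (auto simp: hasse_edges_def ending_at_def)
      show "best \<alpha> \<le> T (hi \<alpha>) \<beta>"
        using best_suffix_mono[OF \<beta>] less.IH[OF _ \<beta>(1)] by simp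
    qed
    ultimately show ?thesis
      using False T_eq[OF less.prems refl] by simp
  qed
qed

subsection \<open>Upper bound\<close>

text \<open>The suffixes of one word form a chain, so Hasse edges lead step by step from the shorter
  suffix to the longer one, and each table entry is at most that of its child.\<close>

lemma T_suffix_le:
  assumes "factor g i s \<in> \<Pi>" "factor g j s \<in> \<Pi>" "i \<le> j" "1 \<le> s"
  shows "T s (factor g j s) \<le> T s (factor g i s)"
  using assms
proof (induction j rule: less_induct)
  case (less j)
  show ?case
  proof (cases "i = j")
    case False
    \<comment> \<open>The start of the next longer suffix in \<Pi>; by its maximality nothing lies
      strictly between, so it gives a child.\<close>
    define k where "k = (GREATEST k. k < j \<and> factor g k s \<in> \<Pi>)"
    have bound: "\<forall>k. k < j \<and> factor g k s \<in> \<Pi> \<longrightarrow> k \<le> j"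
      by simp
    have i: "i < j \<and> factor g i s \<in> \<Pi>"
      using False less.prems by simp
    have k: "k < j \<and> factor g k s \<in> \<Pi>"
      unfolding k_def by (rule GreatestI_nat[where P = "\<lambda>k. k < j \<and> factor g k s \<in> \<Pi>", OF i])
        (use bound in blast)
    have "i \<le> k"
      unfolding k_def by (rule Greatest_le_nat[where P = "\<lambda>k. k < j \<and> factor g k s \<in> \<Pi>", OF i])
        (use bound in blast)
    have greatest: "m \<le> k" if "m < j" "factor g m s \<in> \<Pi>" for m
      unfolding k_def
      by (rule Greatest_le_nat[where P = "\<lambda>k. k < j \<and> factor g k s \<in> \<Pi>" and b = j]) (use that in auto)
    have bounds: "1 \<le> m" "m \<le> s + 1" if "factor g m s \<in> \<Pi>" for m
      using that \<Pi>_patterns by (auto simp: factor_in_patterns_iff)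
    have "(factor g j s, factor g k s) \<in> hasse_edges (ending_at \<Pi> s)"
      unfolding hasse_edges_def
    proof (safe intro!: exI)
      show "factor g j s \<in> ending_at \<Pi> s" "factor g k s \<in> ending_at \<Pi> s"
        using less.prems k by (simp_all add: ending_at_def)
      show "strict_suffix (factor g j s) (factor g k s)"
        using k less.prems bounds by (simp add: strict_suffix_factor_iff)
    next
      fix \<gamma> assume \<gamma>: "\<gamma> \<in> ending_at \<Pi> s" "strict_suffix (factor g j s) \<gamma>"
        "strict_suffix \<gamma> (factor g k s)"
      then have eq: "\<gamma> = factor g (lo \<gamma>) s" and "k < lo \<gamma>"
        using k bounds by (simp_all add: strict_suffix_factor_iff)
      then have \<gamma>\<Pi>: "factor g (lo \<gamma>) s \<in> \<Pi>"
        using \<gamma>(1) by (simp add: ending_at_def)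
      have "lo \<gamma> < j"
        using \<gamma>(2) strict_suffix_factor_iff[OF bounds[OF \<gamma>\<Pi>], of "factor g j s" g] eq by simp
      then show False
        using greatest \<gamma>\<Pi> \<open>k < lo \<gamma>\<close> by fastforce
    qed
    then have "(INF \<beta> \<in> {\<beta>. (factor g j s, \<beta>) \<in> hasse_edges (ending_at \<Pi> s)}. T s \<beta>)
        \<le> T s (factor g k s)"
      by (intro INF_lower) simp
    then have "T s (factor g j s) \<le> T s (factor g k s)"
      using T_eq[OF less.prems(2), of s] less.prems by (simp add: min.coboundedI2)
    also have "\<dots> \<le> T s (factor g i s)"
      using less.IH[of k] less.prems k \<open>i \<le> k\<close> by simp
    finally show ?thesis .
  qed simp
qed

text \<open>Iterating \<open>left_pat\<close> from \<open>factor g i j\<close> cannot jump over the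
  prefix \<open>factor g i k\<close>, and the differences \<psi> along the way telescope.\<close>

lemma T_prefix_le:
  assumes "factor g i k \<in> \<Pi>" "factor g i j \<in> \<Pi>" "k \<le> j"
  shows "T j (factor g i j) \<le> T k (factor g i k) + ereal (f (factor g i j) - f (factor g i k))"
  using assms
proof (induction j rule: less_induct)
  case (less j)
  show ?case
  proof (cases "k = j")
    case False
    have bounds: "i \<le> m + 1" if "factor g i m \<in> \<Pi>" for m
      using that \<Pi>_patterns by (auto simp: factor_in_patterns_iff)
    have pre: "proper_prefix \<alpha> (factor g i j) \<longleftrightarrow>
        lo \<alpha> = i \<and> i \<le> hi \<alpha> + 1 \<and> hi \<alpha> < j \<and> \<alpha> = factor g i (hi \<alpha>)" for \<alpha>
      by (rule proper_prefix_factor_iff) (use bounds less.prems in simp)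
    have "proper_prefix (factor g i k) (factor g i j)"
      using False less.prems bounds[OF less.prems(1)] by (simp add: pre)
    then obtain \<beta> where left: "left_pat \<Pi> (factor g i j) = Some \<beta>"
      and long: "length (word (factor g i k)) \<le> length (word \<beta>)"
      using left_pat_longest less.prems(1) by metis
    define m where "m = hi \<beta>"
    have \<beta>: "\<beta> = factor g i m" "factor g i m \<in> \<Pi>" "m < j"
      using left_pat_SomeD[OF left] unfolding pre m_def by auto
    \<comment> \<open>The prefix ending at \<open>k\<close> competes in the choice of \<beta>, so
      the longest one reaches at least as far.\<close>
    then have "k \<le> m"
      using long bounds[OF less.prems(1)] bounds[OF \<beta>(2)] by simp
    have "T j (factor g i j) \<le> T m (factor g i m) + ereal (f (factor g i j) - f (factor g i m))"
      using T_eq[OF less.prems(2), of j] \<beta> left by (simp del: factor_eq_iff)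
    also have "\<dots> \<le> T k (factor g i k) + ereal (f (factor g i m) - f (factor g i k)) +
        ereal (f (factor g i j) - f (factor g i m))"
      using less.IH[OF \<beta>(3) less.prems(1) \<beta>(2) \<open>k \<le> m\<close>] by (rule add_right_mono)
    also have "\<dots> = T k (factor g i k) + ereal (f (factor g i j) - f (factor g i k))"
      by (simp add: add.assoc)
    finally show ?thesis .
  qed (simp add: zero_ereal_def[symmetric])
qed

text \<open>The labeling is cut at \<open>v\<close>, \<open>i\<close>, \<open>h\<close> and
  \<open>u\<close>. A word in the bracket would be an occurrence starting before \<open>i\<close>
  and ending after \<open>h\<close>, which \<open>gap\<close> excludes. Taking both occurrences
  equal shows that an occurrence can itself be a required pattern.\<close>

lemma overlap_required:
  assumes g: "g ` {1..n} \<subseteq> D" and occ: "occurs g v h" "occurs g i u"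
    and ineq: "v \<le> i" "i \<le> h + 1" "h \<le> u"
    and gap: "\<And>a b. occurs g a b \<Longrightarrow> a < i \<Longrightarrow> b \<le> h"
  shows "factor g i h \<in> \<Pi>"
proof -
  have bounds: "1 \<le> v" "u \<le> n"
    using occursD occ by blast+
  have pat: "factor g a b \<in> patterns D n" if "1 \<le> a" "a \<le> b + 1" "b \<le> n" for a b
    using that g by (auto simp: factor_in_patterns_iff)
  let ?x = "factor g 1 (v - 1)" and ?\<alpha> = "factor g v (i - 1)" and ?\<beta> = "factor g i h"
    and ?\<gamma> = "factor g (h + 1) u" and ?y = "factor g (u + 1) n"
  \<comment> \<open>All partial products that arise from the left-associated concatenation and from
    the bracket.\<close>
  have "?x \<cdot> ?\<alpha> = factor g 1 (i - 1)" "?\<alpha> \<cdot> ?\<beta> = factor g v h" "?\<beta> \<cdot> ?\<gamma> = factor g i u"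
    "?\<gamma> \<cdot> ?y = factor g (h + 1) n"
    "factor g 1 (i - 1) \<cdot> ?\<beta> = factor g 1 h" "factor g 1 h \<cdot> ?\<gamma> = factor g 1 u"
    "factor g 1 u \<cdot> ?y = factor g 1 n" "factor g 1 h \<cdot> factor g (h + 1) n = factor g 1 n"
    using bounds ineq by (auto intro!: factor_cat)
  note cats = this
  have "bracket (factor g 1 (i - 1)) ?\<beta> (factor g (h + 1) n) \<inter> word_patterns D n \<Gamma> = {}"
  proof safe
    fix w assume w: "w \<in> word_patterns D n \<Gamma>"
      and "w \<in> bracket (factor g 1 (i - 1)) ?\<beta> (factor g (h + 1) n)"
    then have inner: "inner_subpattern ?\<beta> w" and "subpattern w (factor g 1 n)"
      unfolding bracket_def cats by simp_all
    then have eq: "w = factor g (lo w) (hi w)" and "lo w \<le> hi w + 1"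
      using n_pos by (simp_all add: subpattern_factor_iff)
    then have "lo w < i" "h < hi w"
      using inner_subpattern_factorD[of ?\<beta> g "lo w" "hi w"] inner by simp_all
    moreover have "occurs g (lo w) (hi w)"
      using w eq by (simp add: occurs_def)
    ultimately show "w \<in> {}"
      using gap by fastforce
  qed
  moreover have "factor g 1 n \<in> labelings D n 1 n"
    using pat[of 1 n] n_pos by (simp add: labelings_def)
  ultimately have "adjacent ?x ?\<alpha> \<and> adjacent ?\<alpha> ?\<beta> \<and> adjacent ?\<beta> ?\<gamma> \<and> adjacent ?\<gamma> ?y \<and>
      ?x \<cdot> ?\<alpha> \<cdot> ?\<beta> \<cdot> ?\<gamma> \<cdot> ?y \<in> labelings D n 1 n \<and>
      ?\<alpha> \<cdot> ?\<beta> \<in> word_patterns D n \<Gamma> \<and> ?\<beta> \<cdot> ?\<gamma> \<in> word_patterns D n \<Gamma> \<and>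
      bracket (?x \<cdot> ?\<alpha>) ?\<beta> (?\<gamma> \<cdot> ?y) \<inter> word_patterns D n \<Gamma> = {}"
    using bounds ineq occ unfolding cats adjacent_def occurs_def by simp
  moreover have "?x \<in> patterns D n" "?\<alpha> \<in> patterns D n" "?\<beta> \<in> patterns D n"
    "?\<gamma> \<in> patterns D n" "?y \<in> patterns D n"
    using bounds ineq by (intro pat; simp)+
  ultimately have "?\<beta> \<in> required_patterns D n \<Gamma>"
    unfolding required_patterns_def by blast
  then show ?thesis
    using \<Pi>_required by auto
qed

text \<open>
  The overlap of an occurrence \<open>[i,u]\<close> with its predecessor \<open>[v,h]\<close>, the occurrence starting
  before \<open>i\<close> that reaches furthest to the right, is a required pattern, and every occurrence
  ending in \<open>(h,u]\<close> lies inside \<open>[i,u]\<close>. So the step from the overlap to \<open>[i,u]\<close> costs exactly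
  the difference of the energies of the two prefixes.
\<close>

lemma T_le_prefix_energy:
  assumes g: "g ` {1..n} \<subseteq> D"
    and covered: "\<And>k. k \<in> {1..n} \<Longrightarrow> \<exists>a b. occurs g a b \<and> a \<le> k \<and> k \<le> b"
    and "occurs g i u" and "\<And>a b. occurs g a b \<Longrightarrow> a < i \<Longrightarrow> b < u"
  shows "T u (factor g i u) \<le> ereal (f (factor g 1 u))"
  using assms(3,4)
proof (induction u arbitrary: i rule: less_induct)
  case (less u)
  note iu = occursD[OF less.prems(1)]
  \<comment> \<open>Both occurrences are \<open>[i,u]\<close>, so the overlap is the whole pattern
    and the outer parts are empty.\<close>
  have u\<Pi>: "factor g i u \<in> \<Pi>"
    by (rule overlap_required[OF g less.prems(1,1)]) (use iu less.prems(2) in \<open>auto intro: less_imp_le\<close>)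
  show ?case
  proof (cases "i = 1")
    case True
    have "empty_pat 0 \<in> \<Pi>"
      using \<Pi>_zero by (auto simp: ending_at_def)
    \<comment> \<open>For \<open>i = 1\<close> the chain starts at the empty pattern at 0, where the
      table has the value 0.\<close>
    then have "factor g i 0 \<in> \<Pi>"
      by (simp add: True empty_pat_def factor_def)
    then have "T u (factor g i u) \<le>
        T 0 (factor g i 0) + ereal (f (factor g i u) - f (factor g i 0))"
      using u\<Pi> by (intro T_prefix_le) simp_all
    also have "\<dots> = ereal (f (factor g 1 u))"
      using f_empty_factor[of 1 g] final_table_zero[of n \<Pi> f ord]
      by (simp add: True empty_pat_def factor_def)
    finally show ?thesis .
  next
    case False
    define before where "before = (\<lambda>b. \<exists>a. occurs g a b \<and> a < i)"
    define h where "h = (GREATEST b. before b)"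
    \<comment> \<open>Covering position \<open>i - 1\<close> rules out a hole between the
      predecessor and \<open>[i,u]\<close>; this later gives \<open>i \<le> h + 1\<close>.\<close>
    obtain b0 where b0: "before b0" "i - 1 \<le> b0"
      using covered[of "i - 1"] iu False unfolding before_def by fastforce
    have bound: "\<forall>b. before b \<longrightarrow> b \<le> n"
      by (auto simp: before_def dest: occursD)
    have h: "before h"
      unfolding h_def using GreatestI_nat[of before b0 n] b0 bound by blast
    have h_max: "b \<le> h" if "before b" for b
      unfolding h_def using Greatest_le_nat[of before b n] that bound by blast
    \<comment> \<open>The leftmost start makes \<open>[v,h]\<close> inclusion-maximal: an occurrence
      starting before \<open>v\<close> ends strictly before \<open>h\<close>, as the induction
      hypothesis demands.\<close>
    define v where "v = (LEAST v. occurs g v h \<and> v < i)"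
    have v: "occurs g v h \<and> v < i"
      unfolding v_def using h unfolding before_def by (rule LeastI_ex)
    have v_min: "v \<le> a" if "occurs g a h" "a < i" for a
      unfolding v_def using that by (intro Least_le) simp
    have gap: "b \<le> h" if "occurs g a b" "a < i" for a b
      using h_max that by (auto simp: before_def)
    have "h < u"
      using less.prems(2) v by blast
    have ih: "i \<le> h + 1"
      using h_max[OF b0(1)] b0(2) by linarith
    have vh: "1 \<le> v" "v \<le> h" "h \<le> n"
      using occursD v by blast+
    have v\<Pi>: "factor g v h \<in> \<Pi>"
      by (rule overlap_required[OF g, of v h v h]) (use v vh gap in auto)
    have \<beta>\<Pi>: "factor g i h \<in> \<Pi>"
      by (rule overlap_required[OF g, of v h i u]) (use v vh ih gap less.prems \<open>h < u\<close> in auto)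
    \<comment> \<open>The overlap is a suffix of \<open>[v,h]\<close>, possibly the empty
      one.\<close>
    have "T h (factor g i h) \<le> T h (factor g v h)"
      by (rule T_suffix_le) (use v\<Pi> \<beta>\<Pi> v vh in auto)
    also have "\<dots> \<le> ereal (f (factor g 1 h))"
    proof (rule less.IH[OF \<open>h < u\<close>])
      fix a b assume "occurs g a b" "a < v"
      then show "b < h"
        using gap[of a b] v_min[of a] v by (cases "b = h") auto
    qed (use v in simp)
    finally have "T u (factor g i u) \<le>
        ereal (f (factor g 1 h)) + ereal (f (factor g i u) - f (factor g i h))"
      using T_prefix_le[OF \<beta>\<Pi> u\<Pi>] \<open>h < u\<close> by (meson add_right_mono less_imp_le order_trans)
    also have "f (factor g i u) - f (factor g i h) = f (factor g 1 u) - f (factor g 1 h)"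
    proof -
      have "{(a, b). i \<le> a \<and> h < b \<and> b \<le> u \<and> occurs g a b} =
          {(a, b). 1 \<le> a \<and> h < b \<and> b \<le> u \<and> occurs g a b}"
        using iu gap by (fastforce simp: not_less[symmetric])
      then show ?thesis
        using iu ih \<open>h < u\<close> by (simp add: f_factor_diff)
    qed
    finally show ?thesis by simp
  qed
qed

section \<open>Reduction to labelings covered by occurrences\<close>

text \<open>Rewriting only uncovered positions preserves every occurrence of \<open>g\<close>; new
  occurrences have nonpositive cost.\<close>

lemma cover_labeling:
  assumes g: "g ` {1..n} \<subseteq> D"
  obtains g' where "g' ` {1..n} \<subseteq> D"
    "\<And>k. k \<in> {1..n} \<Longrightarrow> \<exists>a b. occurs g' a b \<and> a \<le> k \<and> k \<le> b"
    "f (factor g' 1 n) \<le> f (factor g 1 n)"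
proof -
  obtain d where d: "[d] \<in> \<Gamma>"
    using singleton_word by (auto simp: length_Suc_conv)
  then have "d \<in> D" using words by auto
  define C where "C = {k. \<exists>a b. occurs g a b \<and> a \<le> k \<and> k \<le> b}"
  define g' where "g' = (\<lambda>k. if k \<in> C then g k else d)"
  have g': "g' ` {1..n} \<subseteq> D"
    using g \<open>d \<in> D\<close> by (auto simp: g'_def)
  have same: "factor g' a b = factor g a b" if "occurs g a b" for a b
    using that by (auto simp: g'_def C_def)
  then have occ: "occurs g' a b" if "occurs g a b" for a b
    using same[OF that] that by (simp add: occurs_def del: factor_eq_iff)
  have cov: "\<exists>a b. occurs g' a b \<and> a \<le> k \<and> k \<le> b" if k: "k \<in> {1..n}" for k
  proof (cases "k \<in> C")
    case True
    then show ?thesis using occ unfolding C_def by blast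
  next
    case False
    \<comment> \<open>Outside \<open>C\<close> the letter is \<open>d\<close>, so
      \<open>[k,k]\<close> carries a one-letter word of \<Gamma>.\<close>
    have "factor g' k k \<in> patterns D n"
      using k g' by (auto simp: factor_in_patterns_iff)
    then have "occurs g' k k"
      using d False by (simp add: occurs_def word_patterns_def g'_def upt_rec)
    then show ?thesis by blast
  qed
  let ?S = "\<lambda>g. {(a, b). 1 \<le> a \<and> b \<le> n \<and> occurs g a b}"
  \<comment> \<open>The sign change makes all terms nonnegative, so the sum is monotone in the set
    of occurrences.\<close>
  have "- f (factor g 1 n) \<le> - f (factor g' 1 n)"
  proof -
    have "- f (factor g 1 n) = (\<Sum>(a, b) \<in> ?S g. - c (factor g a b))"
      by (simp add: f_factor sum_negf case_prod_unfold)
    also have "\<dots> = (\<Sum>(a, b) \<in> ?S g. - c (factor g' a b))"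
      using same by (intro sum.cong) (auto simp del: factor_eq_iff)
    also have "\<dots> \<le> (\<Sum>(a, b) \<in> ?S g'. - c (factor g' a b))"
      using occ c_nonpos by (intro sum_mono2 finite_occurs[of _ g']) (auto simp: occurs_def[of g'])
    also have "\<dots> = - f (factor g' 1 n)"
      by (simp add: f_factor sum_negf case_prod_unfold)
    finally show ?thesis .
  qed
  then show ?thesis
    using that[of g'] g' cov by simp
qed

section \<open>Comparison of the output with the minimum\<close>

lemma output_le:
  assumes "x \<in> labelings D n 1 n"
  shows "algorithm_output n \<Pi> f ord \<le> ereal (f x)"
proof -
  define g0 where "g0 = (\<lambda>k. word x ! (k - lo x))"
  have x: "x = factor g0 1 n"
    using assms wf_pat_eq_factor[of x] by (auto simp: labelings_def patterns_def g0_def)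
  then have "g0 ` {1..n} \<subseteq> D"
    using assms by (simp add: labelings_def factor_in_patterns_iff)
  then obtain g where g: "g ` {1..n} \<subseteq> D"
    and cov: "\<And>k. k \<in> {1..n} \<Longrightarrow> \<exists>a b. occurs g a b \<and> a \<le> k \<and> k \<le> b"
    and le: "f (factor g 1 n) \<le> f x"
    using cover_labeling x by metis
  \<comment> \<open>Among the occurrences ending at \<open>n\<close>, the one with the leftmost
    start meets the hypothesis that earlier starts end earlier.\<close>
  define i where "i = (LEAST i. occurs g i n)"
  obtain a b where "occurs g a b" "n \<le> b"
    using cov[of n] n_pos by auto
  then have "occurs g a n"
    using occursD(3)[of g a b] by simp
  then have i: "occurs g i n"
    unfolding i_def by (rule LeastI)
  have i_min: "b < n" if "occurs g a b" "a < i" for a b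
    using that occursD(3)[of g a b] not_less_Least[of a "\<lambda>i. occurs g i n"]
    unfolding i_def by (cases "b = n") auto
  have "factor g i n \<in> \<Pi>"
    by (rule overlap_required[OF g i i]) (use occursD[OF i] i_min in \<open>auto intro: less_imp_le\<close>)
  then have "algorithm_output n \<Pi> f ord \<le> T n (factor g i n)"
    unfolding algorithm_output_def by (intro INF_lower) (simp add: ending_at_def)
  also have "\<dots> \<le> ereal (f (factor g 1 n))"
    using T_le_prefix_energy[OF g cov i i_min] .
  finally show ?thesis
    using le by (meson ereal_less_eq(3) order_trans)
qed

text \<open>For \<alpha> ending at \<open>n\<close>, each completion is a labeling of all of
  \<open>[1,n]\<close>, so a lower bound on energies passes to \<open>best \<alpha>\<close> and from
  there to the table.\<close>

lemma output_ge:
  assumes "\<And>x. x \<in> labelings D n 1 n \<Longrightarrow> z \<le> f x"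
  shows "ereal z \<le> algorithm_output n \<Pi> f ord"
  unfolding algorithm_output_def
proof (rule INF_greatest)
  fix \<alpha> assume "\<alpha> \<in> ending_at \<Pi> n"
  then have \<alpha>: "\<alpha> \<in> \<Pi>" "hi \<alpha> = n"
    by (simp_all add: ending_at_def)
  have "ereal z \<le> best \<alpha>"
    unfolding best_def
  proof (rule INF_greatest)
    fix g assume "g \<in> completions \<alpha>"
    then have "factor g 1 n \<in> labelings D n 1 n"
      using n_pos by (simp add: completions_def \<alpha> labelings_def factor_in_patterns_iff)
    then show "ereal z \<le> ereal (f (factor g 1 (hi \<alpha>)))"
      using assms \<alpha> by simp
  qed
  also have "\<dots> \<le> T n \<alpha>"
    using best_le_T[OF \<alpha>(1)] \<alpha>(2) by simp
  finally show "ereal z \<le> T n \<alpha>" .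
qed

lemma output_eq: "algorithm_output n \<Pi> f ord = ereal (Min (f ` labelings D n 1 n))"
proof (rule antisym)
  \<comment> \<open>A constant labeling shows that the set under \<open>Min\<close> is
    nonempty.\<close>
  obtain d where "d \<in> D"
    using singleton_word words by (auto simp: length_Suc_conv)
  then have "factor (\<lambda>_. d) 1 n \<in> labelings D n 1 n"
    by (auto simp: labelings_def factor_in_patterns_iff)
  then have fin: "finite (f ` labelings D n 1 n)" "f ` labelings D n 1 n \<noteq> {}"
    using finite_labelings[OF finite_D] by auto
  show "algorithm_output n \<Pi> f ord \<le> ereal (Min (f ` labelings D n 1 n))"
    using Min_in[OF fin] output_le by auto
  show "ereal (Min (f ` labelings D n 1 n)) \<le> algorithm_output n \<Pi> f ord"
    using fin by (intro output_ge) simp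
qed

end

theorem theorem14:
  fixes D :: "'d set" and n :: nat and \<Gamma> :: "'d list set"
    and c :: "'d pattern \<Rightarrow> real" and \<Pi> :: "'d pattern set"
    and ord :: "nat \<Rightarrow> 'd pattern list"
  assumes "finite D" and "n \<ge> 1"
    and "finite \<Gamma>" and "\<forall>w \<in> \<Gamma>. w \<noteq> [] \<and> set w \<subseteq> D"
    and "\<forall>\<alpha> \<in> word_patterns D n \<Gamma>. c \<alpha> \<le> 0"
    and "\<exists>w \<in> \<Gamma>. length w = 1"
    and "\<Pi> \<subseteq> patterns D n"
    and "ending_at \<Pi> 0 = {empty_pat 0}"
    and "required_patterns D n \<Gamma> \<subseteq> \<Pi>"
    and "\<forall>s \<in> {1..n}. leaves_first (ending_at \<Pi> s) (ord s)"
  shows "algorithm_output n \<Pi> (energy D n \<Gamma> c) ord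
           = ereal (Min (energy D n \<Gamma> c ` labelings D n 1 n))"
proof -
  interpret pattern_minimization D n \<Gamma> c \<Pi> ord
    using assms by unfold_locales
  show ?thesis
    by (rule output_eq)
qed

end
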